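(* Let $G$ be a group, let $R$ be a $G$-graded ring, and let $K$ be a graded ideal of $R$ (i.e. a proper two-sided ideal that is graded). Suppose that $P$ is a graded right ideal of $R$ such that $K\subseteq P$. If $P$ is a graded almost prime right ideal of $R$, then $P/K$ is a graded almost prime right ideal of $R/K$.
   Context: Rings are associative, not assumed commutative, and not assumed to have a unity. A ring $R$ is $G$-graded if $R=\bigoplus_{g\in G}R_g$ with $R_g$ additive subgroups and $R_gR_h\subseteq R_{gh}$ for all $g,h\in G$; $x_g$ denotes the component of $x\in R$ in $R_g$. A (one- or two-sided) ideal $P$ is graded if $P=\bigoplus_{g\in G}(P\cap R_g)$, i.e. $x\in P$ implies $x_g\in P$ for all $g\in G$. By "ideal" is meant a proper two-sided ideal. The product $XY$ of right ideals is the set of finite sums of products $xy$ with $x\in X$, $y\in Y$, and $P^2=PP$. For a graded two-sided ideal $K$ of $R$, the quotient $R/K$ is $G$-graded by $(R/K)_g=(R_g+K)/K$. A proper graded right ideal $P$ of a graded ring $R$ is graded almost prime if, for all graded right ideals $X,Y$ of $R$, $XY\subseteq P$ and $XY\nsubseteq P^2$ imply $X\subseteq P$ or $Y\subseteq P$. *)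

theory Defs
  imports "HOL-Algebra.QuotRing" "HOL-Algebra.Ideal_Product"
begin

text \<open>
  The library locale \<^locale>\<open>ring\<close> requires a unity. The locale below does not: it uses the same
  record type, but the field \<open>one\<close> is never mentioned and may be any value. The record
  operations \<^const>\<open>FactRing\<close> (written \<open>R Quot K\<close>), \<^const>\<open>ideal_prod\<close> (written \<open>X \<cdot> Y\<close>) and the
  predicate \<^locale>\<open>additive_subgroup\<close> make sense in this setting and are reused.
\<close>

locale nonunital_ring = abelian_group R for R (structure) +
  assumes mult_closed: "\<lbrakk> x \<in> carrier R; y \<in> carrier R \<rbrakk> \<Longrightarrow> x \<otimes> y \<in> carrier R"
    and mult_assoc: "\<lbrakk> x \<in> carrier R; y \<in> carrier R; z \<in> carrier R \<rbrakk>
      \<Longrightarrow> (x \<otimes> y) \<otimes> z = x \<otimes> (y \<otimes> z)"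
    and left_distrib: "\<lbrakk> x \<in> carrier R; y \<in> carrier R; z \<in> carrier R \<rbrakk>
      \<Longrightarrow> (x \<oplus> y) \<otimes> z = x \<otimes> z \<oplus> y \<otimes> z"
    and right_distrib: "\<lbrakk> x \<in> carrier R; y \<in> carrier R; z \<in> carrier R \<rbrakk>
      \<Longrightarrow> z \<otimes> (x \<oplus> y) = z \<otimes> x \<oplus> z \<otimes> y"

locale right_ideal = nonunital_ring R + additive_subgroup P R
  for R (structure) and P +
  assumes right_closed: "\<lbrakk> x \<in> P; r \<in> carrier R \<rbrakk> \<Longrightarrow> x \<otimes> r \<in> P"

locale proper_two_sided_ideal = right_ideal R K
  for R (structure) and K +
  assumes left_closed: "\<lbrakk> x \<in> K; r \<in> carrier R \<rbrakk> \<Longrightarrow> r \<otimes> x \<in> K"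
    and proper: "K \<noteq> carrier R"

text \<open>
  \<open>f\<close> is a family of homogeneous elements with finite support and sum \<open>x\<close>. The sum is taken over
  the support because \<^const>\<open>finsum\<close> over an infinite index set is zero by convention; \<open>f\<close> is
  required to be extensional so that it is determined by its values on \<open>carrier G\<close>.
\<close>

definition homogeneous_decomposition ::
  "('a, 'm) ring_scheme \<Rightarrow> ('g, 'n) monoid_scheme \<Rightarrow> ('g \<Rightarrow> 'a set) \<Rightarrow> 'a \<Rightarrow> ('g \<Rightarrow> 'a) \<Rightarrow> bool"
  where "homogeneous_decomposition R G Rg x f \<longleftrightarrow>
    f \<in> (\<Pi>\<^sub>E g\<in>carrier G. Rg g) \<and>
    finite {g \<in> carrier G. f g \<noteq> \<zero>\<^bsub>R\<^esub>} \<and>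
    x = finsum R f {g \<in> carrier G. f g \<noteq> \<zero>\<^bsub>R\<^esub>}"

definition component ::
  "('a, 'm) ring_scheme \<Rightarrow> ('g, 'n) monoid_scheme \<Rightarrow> ('g \<Rightarrow> 'a set) \<Rightarrow> 'a \<Rightarrow> 'g \<Rightarrow> 'a"
  where "component R G Rg x = (THE f. homogeneous_decomposition R G Rg x f)"

locale graded_ring = nonunital_ring R + grading_group: group G
  for R (structure) and G and Rg +
  assumes homogeneous_subgroup: "g \<in> carrier G \<Longrightarrow> additive_subgroup (Rg g) R"
    and direct_sum: "x \<in> carrier R \<Longrightarrow> \<exists>!f. homogeneous_decomposition R G Rg x f"
    and homogeneous_mult: "\<lbrakk> g \<in> carrier G; h \<in> carrier G; x \<in> Rg g; y \<in> Rg h \<rbrakk>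
      \<Longrightarrow> x \<otimes> y \<in> Rg (g \<otimes>\<^bsub>G\<^esub> h)"

definition graded_subset ::
  "('a, 'm) ring_scheme \<Rightarrow> ('g, 'n) monoid_scheme \<Rightarrow> ('g \<Rightarrow> 'a set) \<Rightarrow> 'a set \<Rightarrow> bool"
  where "graded_subset R G Rg P \<longleftrightarrow> (\<forall>x\<in>P. \<forall>g\<in>carrier G. component R G Rg x g \<in> P)"

locale graded_right_ideal = graded_ring R G Rg + right_ideal R P
  for R (structure) and G and Rg and P +
  assumes graded: "graded_subset R G Rg P"

locale graded_proper_two_sided_ideal = graded_ring R G Rg + proper_two_sided_ideal R K
  for R (structure) and G and Rg and K +
  assumes graded: "graded_subset R G Rg K"

text \<open>
  \<^const>\<open>ideal_prod\<close> generates the nonempty finite sums of products; for right ideals the empty sum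
  adds nothing, as \<open>\<zero> = \<zero> \<otimes> \<zero>\<close>. The right ideals \<open>X\<close> and \<open>Y\<close> need not be proper.
\<close>

locale graded_almost_prime_right_ideal = graded_right_ideal R G Rg P
  for R (structure) and G and Rg and P +
  assumes proper: "P \<noteq> carrier R"
    and almost_prime: "\<lbrakk> graded_right_ideal R G Rg X; graded_right_ideal R G Rg Y;
      X \<cdot> Y \<subseteq> P; \<not> X \<cdot> Y \<subseteq> P \<cdot> P \<rbrakk> \<Longrightarrow> X \<subseteq> P \<or> Y \<subseteq> P"

definition quotient_subset :: "('a, 'm) ring_scheme \<Rightarrow> 'a set \<Rightarrow> 'a set \<Rightarrow> 'a set set"
  where "quotient_subset R K S = (\<lambda>x. K +>\<^bsub>R\<^esub> x) ` S"

definition quotient_grading ::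
  "('a, 'm) ring_scheme \<Rightarrow> 'a set \<Rightarrow> ('g \<Rightarrow> 'a set) \<Rightarrow> 'g \<Rightarrow> 'a set set"
  where "quotient_grading R K Rg g = quotient_subset R K (Rg g <+>\<^bsub>R\<^esub> K)"

end

theory Submission
  imports Defs
begin

text \<open>
  Let \<open>\<pi>\<close> denote the projection of \<open>R\<close> onto \<open>R/K\<close>, i.e. the map \<open>x \<mapsto> K +> x\<close>. Graded right ideals
  \<open>X'\<close> and \<open>Y'\<close> of \<open>R/K\<close> are the images of their preimages \<open>X\<close> and \<open>Y\<close>, which are graded right
  ideals of \<open>R\<close>, and \<open>\<pi>\<close> maps \<open>X \<cdot> Y\<close> onto \<open>X' \<cdot> Y'\<close> and \<open>P \<cdot> P\<close> onto \<open>(P/K) \<cdot> (P/K)\<close>. Suppose that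
  \<open>X' \<cdot> Y' \<subseteq> P/K\<close> and \<open>X' \<cdot> Y' \<not>\<subseteq> (P/K) \<cdot> (P/K)\<close>. The first inclusion lifts to \<open>X \<cdot> Y \<subseteq> P\<close> because
  \<open>K \<subseteq> P\<close> makes \<open>P\<close> a union of cosets of \<open>K\<close>. Applying \<open>\<pi>\<close> to an inclusion
  \<open>X \<cdot> Y \<subseteq> P \<cdot> P\<close> would contradict the second assumption, so \<open>X \<cdot> Y \<not>\<subseteq> P \<cdot> P\<close>.
  Now \<open>P\<close> being almost prime gives \<open>X \<subseteq> P\<close> or \<open>Y \<subseteq> P\<close>, and applying \<open>\<pi>\<close> finishes the argument.

  The substance lies in showing that \<open>R/K\<close> is graded, with \<open>\<pi>\<close> preserving components
  (\<open>quotient_decomposition_unique\<close> and \<open>component_quotient\<close> below). A decomposition of \<open>\<pi> x\<close> lifts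
  term by term to a decomposition of some \<open>z\<close> with \<open>\<pi> z = \<pi> x\<close>. Then \<open>z\<close> and \<open>x\<close> differ by an
  element of \<open>K\<close>, whose components are again in \<open>K\<close> since \<open>K\<close> is graded; so the components of \<open>z\<close>
  and \<open>x\<close> agree modulo \<open>K\<close>.
\<close>

section \<open>Components in a graded ring\<close>

context graded_ring
begin

lemma homogeneous_carrier: "g \<in> carrier G \<Longrightarrow> x \<in> Rg g \<Longrightarrow> x \<in> carrier R"
  using additive_subgroup.a_Hcarr[OF homogeneous_subgroup] .

text \<open>
  Any finite sum of homogeneous elements of distinct degrees is a decomposition, even when some of
  its terms vanish. Components can thus be computed from index sets larger than the support,
  such as the union of two supports.
\<close>

lemma homogeneous_decomposition_finsum:
  assumes "finite A" "A \<subseteq> carrier G" and f: "\<And>g. g \<in> A \<Longrightarrow> f g \<in> Rg g"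
  shows "homogeneous_decomposition R G Rg (finsum R f A)
    (\<lambda>g\<in>carrier G. if g \<in> A then f g else \<zero>)"
proof -
  let ?F = "\<lambda>g\<in>carrier G. if g \<in> A then f g else \<zero>"
  have supp: "{g \<in> carrier G. ?F g \<noteq> \<zero>} = {g \<in> A. f g \<noteq> \<zero>}"
    using assms(2) by auto
  have "finsum R f A = finsum R ?F {g \<in> A. f g \<noteq> \<zero>}"
    using assms homogeneous_carrier
    by (intro add.finprod_mono_neutral_cong_right) (auto simp: Pi_def)
  moreover have "?F \<in> (\<Pi>\<^sub>E g\<in>carrier G. Rg g)"
    using f additive_subgroup.zero_closed[OF homogeneous_subgroup] by auto
  ultimately show ?thesis
    using assms(1) unfolding homogeneous_decomposition_def supp by auto
qed

lemma component_unique: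
  assumes "x \<in> carrier R" "homogeneous_decomposition R G Rg x f"
  shows "component R G Rg x = f"
  unfolding component_def by (rule the1_equality[OF direct_sum]) fact+

lemma component_decomposition:
  "x \<in> carrier R \<Longrightarrow> homogeneous_decomposition R G Rg x (component R G Rg x)"
  unfolding component_def by (rule theI'[OF direct_sum])

lemma component_finsum:
  assumes "finite A" "A \<subseteq> carrier G" and f: "\<And>g. g \<in> A \<Longrightarrow> f g \<in> Rg g" and "g \<in> carrier G"
  shows "component R G Rg (finsum R f A) g = (if g \<in> A then f g else \<zero>)"
proof -
  have "finsum R f A \<in> carrier R"
    using assms homogeneous_carrier by (intro finsum_closed) auto
  from component_unique[OF this homogeneous_decomposition_finsum[OF assms(1-3)]] assms(4)
  show ?thesis by simp
qed

lemma component_homogeneous: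
  "x \<in> carrier R \<Longrightarrow> g \<in> carrier G \<Longrightarrow> component R G Rg x g \<in> Rg g"
  using component_decomposition[of x] unfolding homogeneous_decomposition_def by auto

lemma component_carrier:
  "x \<in> carrier R \<Longrightarrow> g \<in> carrier G \<Longrightarrow> component R G Rg x g \<in> carrier R"
  using component_homogeneous homogeneous_carrier by blast

lemma finite_component_support:
  "x \<in> carrier R \<Longrightarrow> finite {g \<in> carrier G. component R G Rg x g \<noteq> \<zero>}"
  using component_decomposition[of x] unfolding homogeneous_decomposition_def by blast

lemma finsum_component:
  assumes x: "x \<in> carrier R" and "finite A" "A \<subseteq> carrier G"
    and "{g \<in> carrier G. component R G Rg x g \<noteq> \<zero>} \<subseteq> A"
  shows "finsum R (component R G Rg x) A = x"
proof -
  have "finsum R (component R G Rg x) A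
      = finsum R (component R G Rg x) {g \<in> carrier G. component R G Rg x g \<noteq> \<zero>}"
    using assms component_carrier
    by (intro add.finprod_mono_neutral_cong_right) auto
  also have "\<dots> = x"
    using component_decomposition[OF x] unfolding homogeneous_decomposition_def by simp
  finally show ?thesis .
qed

lemma component_add:
  assumes x: "x \<in> carrier R" and y: "y \<in> carrier R" and g: "g \<in> carrier G"
  shows "component R G Rg (x \<oplus> y) g = component R G Rg x g \<oplus> component R G Rg y g"
proof -
  let ?c = "component R G Rg"
  let ?A = "{g \<in> carrier G. ?c x g \<noteq> \<zero>} \<union> {g \<in> carrier G. ?c y g \<noteq> \<zero>}"
  have A: "finite ?A" "?A \<subseteq> carrier G"
    using finite_component_support x y by auto
  have "finsum R (\<lambda>g. ?c x g \<oplus> ?c y g) ?A = finsum R (?c x) ?A \<oplus> finsum R (?c y) ?A"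
    using A component_carrier x y by (intro finsum_addf) auto
  also have "\<dots> = x \<oplus> y"
    using finsum_component[OF x A] finsum_component[OF y A] by simp
  finally have "?c (x \<oplus> y) g = ?c (finsum R (\<lambda>g. ?c x g \<oplus> ?c y g) ?A) g"
    by simp
  also have "\<dots> = (if g \<in> ?A then ?c x g \<oplus> ?c y g else \<zero>)"
    using A g x y component_homogeneous
    by (intro component_finsum) (auto intro!: additive_subgroup.a_closed[OF homogeneous_subgroup])
  also have "\<dots> = ?c x g \<oplus> ?c y g"
    using g by auto
  finally show ?thesis .
qed

end


section \<open>Quotients of rings without unity\<close>

sublocale proper_two_sided_ideal \<subseteq> abelian_subgroup K R
  by (intro abelian_subgroupI3 additive_subgroup_axioms abelian_group_axioms)

context proper_two_sided_ideal
begin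

lemma carrier_quotient: "carrier (R Quot K) = (\<lambda>x. K +> x) ` carrier R"
  by (auto simp: FactRing_def A_RCOSETS_def')

lemma zero_quotient: "\<zero>\<^bsub>R Quot K\<^esub> = K"
  by (simp add: FactRing_def)

lemma coset_add:
  "x \<in> carrier R \<Longrightarrow> y \<in> carrier R \<Longrightarrow> (K +> x) \<oplus>\<^bsub>R Quot K\<^esub> (K +> y) = K +> (x \<oplus> y)"
  by (simp add: FactRing_def a_rcos_sum)

lemma coset_eqE:
  assumes "x \<in> carrier R" "K +> x = K +> y" "y \<in> carrier R"
  obtains k where "k \<in> K" "x = k \<oplus> y"
  using a_rcos_self[OF assms(1)] assms(2) by (auto simp: a_r_coset_def')

lemma coset_absorb: "k \<in> K \<Longrightarrow> x \<in> carrier R \<Longrightarrow> K +> (k \<oplus> x) = K +> x"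
  using a_coset_add_assoc[of K k x] a_rcos_const[of k] a_subset by auto

text \<open>
  The product of two cosets is the union of the cosets of all products of representatives. It is a
  single coset because \<open>(k + x)(l + y) = k(l + y) + xl + xy\<close>, where both \<open>k(l + y)\<close> and \<open>xl\<close> are
  in \<open>K\<close>.
\<close>

lemma coset_mult:
  assumes x: "x \<in> carrier R" and y: "y \<in> carrier R"
  shows "(K +> x) \<otimes>\<^bsub>R Quot K\<^esub> (K +> y) = K +> (x \<otimes> y)"
proof -
  have indep: "K +> (a \<otimes> b) = K +> (x \<otimes> y)" if a: "a \<in> K +> x" and b: "b \<in> K +> y" for a b
  proof -
    obtain k l where kl: "k \<in> K" "l \<in> K" "a = k \<oplus> x" "b = l \<oplus> y"
      using a b by (auto simp: a_r_coset_def')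
    have c: "k \<in> carrier R" "l \<in> carrier R" "b \<in> carrier R"
      using kl y by auto
    have "a \<otimes> b = k \<otimes> b \<oplus> x \<otimes> b"
      using c x by (simp add: kl(3) left_distrib)
    also have "x \<otimes> b = x \<otimes> l \<oplus> x \<otimes> y"
      using c x y by (simp add: kl(4) right_distrib)
    also have "k \<otimes> b \<oplus> (x \<otimes> l \<oplus> x \<otimes> y) = (k \<otimes> b \<oplus> x \<otimes> l) \<oplus> x \<otimes> y"
      using c x y by (simp add: mult_closed a_assoc)
    finally show ?thesis
      using kl c x y by (simp add: coset_absorb mult_closed right_closed left_closed)
  qed
  have "(K +> x) \<otimes>\<^bsub>R Quot K\<^esub> (K +> y) = (\<Union>a\<in>K +> x. \<Union>b\<in>K +> y. K +> (a \<otimes> b))"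
    by (simp add: FactRing_def rcoset_mult_def)
  also have "\<dots> = (\<Union>a\<in>K +> x. \<Union>b\<in>K +> y. K +> (x \<otimes> y))"
    using indep by auto
  also have "\<dots> = K +> (x \<otimes> y)"
    using a_rcos_self[OF x] a_rcos_self[OF y] by auto
  finally show ?thesis .
qed

lemma nonunital_ring_quotient: "nonunital_ring (R Quot K)"
proof -
  have ab: "abelian_group (R Quot K)"
    by (rule comm_group_abelian_groupI)
      (simp add: FactRing_def a_factorgroup_is_comm_group[unfolded A_FactGroup_def'])
  show ?thesis
    by (intro nonunital_ring.intro ab nonunital_ring_axioms.intro)
      (auto simp: carrier_quotient coset_mult coset_add mult_closed mult_assoc
        left_distrib right_distrib)
qed

lemma abelian_group_hom_coset: "abelian_group_hom R (R Quot K) (\<lambda>x. K +> x)"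
proof -
  interpret Q: nonunital_ring "R Quot K"
    by (rule nonunital_ring_quotient)
  show ?thesis
    by (intro abelian_group_homI abelian_group_axioms Q.abelian_group_axioms group_hom.intro
        group_hom_axioms.intro a_group Q.a_group homI)
      (auto simp: carrier_quotient coset_add)
qed

lemma coset_finsum:
  assumes "finite A" "\<And>i. i \<in> A \<Longrightarrow> f i \<in> carrier R"
  shows "finsum (R Quot K) (\<lambda>i. K +> f i) A = K +> finsum R f A"
proof -
  interpret Q: nonunital_ring "R Quot K"
    by (rule nonunital_ring_quotient)
  interpret h: abelian_group_hom R "R Quot K" "\<lambda>x. K +> x"
    by (rule abelian_group_hom_coset)
  show ?thesis
    using assms by (induction A rule: finite_induct) (simp_all add: Pi_def)
qed

lemma additive_subgroup_image:
  assumes "additive_subgroup H R"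
  shows "additive_subgroup ((\<lambda>x. K +> x) ` H) (R Quot K)"
proof -
  interpret h: abelian_group_hom R "R Quot K" "\<lambda>x. K +> x"
    by (rule abelian_group_hom_coset)
  show ?thesis
    using group_hom.subgroup_img_is_subgroup[OF h.a_group_hom additive_subgroup.a_subgroup[OF assms]]
    by (rule additive_subgroup.intro)
qed

lemma right_ideal_image:
  assumes "right_ideal R X"
  shows "right_ideal (R Quot K) ((\<lambda>x. K +> x) ` X)"
proof -
  interpret X: right_ideal R X by fact
  show ?thesis
    by (intro right_ideal.intro nonunital_ring_quotient additive_subgroup_image
        X.additive_subgroup_axioms right_ideal_axioms.intro)
      (auto simp: carrier_quotient coset_mult X.right_closed)
qed

lemma right_ideal_preimage:
  assumes "right_ideal (R Quot K) Z"
  shows "right_ideal R {x \<in> carrier R. K +> x \<in> Z}"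
proof -
  interpret Z: right_ideal "R Quot K" Z by fact
  interpret h: abelian_group_hom R "R Quot K" "\<lambda>x. K +> x"
    by (rule abelian_group_hom_coset)
  have "additive_subgroup {x \<in> carrier R. K +> x \<in> Z} R"
    using Z.a_closed Z.a_inv_closed Z.zero_closed h.hom_zero
    by (intro additive_subgroup.intro add.subgroupI) auto
  then show ?thesis
    using Z.right_closed
    by (intro right_ideal.intro nonunital_ring_axioms right_ideal_axioms.intro)
      (auto simp: mult_closed carrier_quotient simp flip: coset_mult)
qed

lemma image_preimage:
  "Z \<subseteq> carrier (R Quot K) \<Longrightarrow> (\<lambda>x. K +> x) ` {x \<in> carrier R. K +> x \<in> Z} = Z"
  by (auto simp: carrier_quotient)

lemma ideal_prod_carrier:
  assumes "X \<subseteq> carrier R" "Y \<subseteq> carrier R"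
  shows "X \<cdot> Y \<subseteq> carrier R"
proof
  fix s assume "s \<in> X \<cdot> Y"
  then show "s \<in> carrier R"
    using assms by induction (auto intro: mult_closed)
qed

lemma image_ideal_prod:
  assumes X: "X \<subseteq> carrier R" and Y: "Y \<subseteq> carrier R"
  shows "(\<lambda>x. K +> x) ` (X \<cdot> Y) = (\<lambda>x. K +> x) ` X \<cdot>\<^bsub>R Quot K\<^esub> (\<lambda>x. K +> x) ` Y"
proof (intro equalityI subsetI)
  fix a assume "a \<in> (\<lambda>x. K +> x) ` (X \<cdot> Y)"
  then obtain s where s: "s \<in> X \<cdot> Y" and a: "a = K +> s" by auto
  from s have "K +> s \<in> (\<lambda>x. K +> x) ` X \<cdot>\<^bsub>R Quot K\<^esub> (\<lambda>x. K +> x) ` Y"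
  proof induction
    case (prod i j)
    then have "K +> (i \<otimes> j) = (K +> i) \<otimes>\<^bsub>R Quot K\<^esub> (K +> j)"
      using X Y by (intro coset_mult[symmetric]) auto
    then show ?case using prod by (auto intro: ideal_prod.prod)
  next
    case (sum s t)
    then have "K +> (s \<oplus> t) = (K +> s) \<oplus>\<^bsub>R Quot K\<^esub> (K +> t)"
      using ideal_prod_carrier[OF X Y] by (intro coset_add[symmetric]) auto
    then show ?case using sum by (auto intro: ideal_prod.sum)
  qed
  then show "a \<in> (\<lambda>x. K +> x) ` X \<cdot>\<^bsub>R Quot K\<^esub> (\<lambda>x. K +> x) ` Y"
    using a by simp
next
  fix a assume "a \<in> (\<lambda>x. K +> x) ` X \<cdot>\<^bsub>R Quot K\<^esub> (\<lambda>x. K +> x) ` Y"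
  then show "a \<in> (\<lambda>x. K +> x) ` (X \<cdot> Y)"
  proof induction
    case (prod i j)
    then obtain x y where "x \<in> X" "y \<in> Y" "i = K +> x" "j = K +> y" by auto
    then show ?case
      using X Y by (auto simp: coset_mult subset_iff intro!: imageI ideal_prod.prod)
  next
    case (sum s t)
    then obtain x y where "x \<in> X \<cdot> Y" "y \<in> X \<cdot> Y" "s = K +> x" "t = K +> y" by auto
    then show ?case
      using ideal_prod_carrier[OF X Y]
      by (auto simp: coset_add subset_iff intro!: imageI ideal_prod.sum)
  qed
qed

lemma coset_mem_image_iff:
  assumes "additive_subgroup P R" "K \<subseteq> P" "x \<in> carrier R"
  shows "K +> x \<in> (\<lambda>x. K +> x) ` P \<longleftrightarrow> x \<in> P"
proof
  interpret P: additive_subgroup P R by fact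
  assume "K +> x \<in> (\<lambda>x. K +> x) ` P"
  then obtain p where p: "p \<in> P" "K +> x = K +> p" by auto
  then obtain k where "k \<in> K" "x = k \<oplus> p"
    using coset_eqE assms(3) P.a_Hcarr by metis
  then show "x \<in> P"
    using p assms(2) P.a_closed by auto
qed auto

end


section \<open>The grading of the quotient\<close>

context graded_proper_two_sided_ideal
begin

lemma quotient_grading_eq:
  assumes "g \<in> carrier G"
  shows "quotient_grading R K Rg g = (\<lambda>x. K +> x) ` Rg g"
proof -
  have *: "K +> (x \<oplus> k) = K +> x" if "x \<in> Rg g" "k \<in> K" for x k
    using that homogeneous_carrier[OF assms] coset_absorb[of k x] by (simp add: a_comm)
  have "quotient_grading R K Rg g = {K +> (x \<oplus> k) | x k. x \<in> Rg g \<and> k \<in> K}"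
    by (auto simp: quotient_grading_def quotient_subset_def set_add_def')
  also have "\<dots> = {K +> x | x k. x \<in> Rg g \<and> k \<in> K}"
    using * by (metis (lifting))
  also have "\<dots> = (\<lambda>x. K +> x) ` Rg g"
    using zero_closed by blast
  finally show ?thesis .
qed

lemma homogeneous_decomposition_quotient:
  assumes x: "x \<in> carrier R"
  shows "homogeneous_decomposition (R Quot K) G (quotient_grading R K Rg) (K +> x)
    (\<lambda>g\<in>carrier G. K +> component R G Rg x g)"
proof -
  interpret Q: nonunital_ring "R Quot K"
    by (rule nonunital_ring_quotient)
  let ?c = "component R G Rg x"
  let ?F = "\<lambda>g\<in>carrier G. K +> ?c g"
  let ?A = "{g \<in> carrier G. ?c g \<noteq> \<zero>}"
  let ?B = "{g \<in> carrier G. ?F g \<noteq> \<zero>\<^bsub>R Quot K\<^esub>}"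
  \<comment> \<open>Components in \<open>K\<close> disappear, so the support can shrink.\<close>
  have BA: "?B \<subseteq> ?A"
    using a_rcos_const[OF zero_closed] by (auto simp: zero_quotient)
  have A: "finite ?A" "?A \<subseteq> carrier G"
    using finite_component_support[OF x] by auto
  have cA: "?c g \<in> carrier R" if "g \<in> ?A" for g
    using component_carrier[OF x] that by auto
  have "K +> x = K +> finsum R ?c ?A"
    using finsum_component[OF x A] by simp
  also have "\<dots> = finsum (R Quot K) (\<lambda>g. K +> ?c g) ?A"
    by (rule coset_finsum[OF A(1) cA, symmetric])
  also have "\<dots> = finsum (R Quot K) ?F ?B"
    using A BA cA
    by (intro Q.add.finprod_mono_neutral_cong_right) (auto simp: carrier_quotient)
  finally have "K +> x = finsum (R Quot K) ?F ?B" .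
  moreover have "?F \<in> (\<Pi>\<^sub>E g\<in>carrier G. quotient_grading R K Rg g)"
    using component_homogeneous[OF x] by (auto simp: quotient_grading_eq)
  ultimately show ?thesis
    using finite_subset[OF BA A(1)] unfolding homogeneous_decomposition_def by blast
qed

lemma coset_component_cong:
  assumes "x \<in> carrier R" "y \<in> carrier R" "K +> x = K +> y" "g \<in> carrier G"
  shows "K +> component R G Rg x g = K +> component R G Rg y g"
proof -
  obtain k where k: "k \<in> K" "x = k \<oplus> y"
    using coset_eqE assms by metis
  have "component R G Rg k g \<in> K"
    using graded k(1) assms(4) unfolding graded_subset_def by blast
  then show ?thesis
    using k assms by (simp add: component_add coset_absorb component_carrier)
qed

text \<open>
  Lifting the terms of a decomposition to homogeneous elements of \<open>R\<close> and summing them up yields a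
  representative of the same coset, and components are determined modulo \<open>K\<close> by the coset.
\<close>

lemma quotient_decomposition_unique:
  assumes x: "x \<in> carrier R"
    and F: "homogeneous_decomposition (R Quot K) G (quotient_grading R K Rg) (K +> x) F"
  shows "F = (\<lambda>g\<in>carrier G. K +> component R G Rg x g)"
proof -
  interpret Q: nonunital_ring "R Quot K"
    by (rule nonunital_ring_quotient)
  let ?A = "{g \<in> carrier G. F g \<noteq> \<zero>\<^bsub>R Quot K\<^esub>}"
  have A: "finite ?A" "?A \<subseteq> carrier G" and sum: "K +> x = finsum (R Quot K) F ?A"
    and hom: "F \<in> (\<Pi>\<^sub>E g\<in>carrier G. quotient_grading R K Rg g)"
    using F unfolding homogeneous_decomposition_def by auto
  have "\<forall>g\<in>carrier G. \<exists>c\<in>Rg g. F g = K +> c"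
    using hom by (auto simp: PiE_iff quotient_grading_eq)
  then obtain c where c: "\<And>g. g \<in> carrier G \<Longrightarrow> c g \<in> Rg g"
    "\<And>g. g \<in> carrier G \<Longrightarrow> F g = K +> c g"
    by metis
  have c_carrier: "c g \<in> carrier R" if "g \<in> carrier G" for g
    using c(1) homogeneous_carrier that by blast
  let ?z = "finsum R c ?A"
  have z: "?z \<in> carrier R"
    using c_carrier by (intro finsum_closed) auto
  have "K +> ?z = finsum (R Quot K) (\<lambda>g. K +> c g) ?A"
    using A c_carrier by (intro coset_finsum[symmetric]) auto
  also have "\<dots> = finsum (R Quot K) F ?A"
    using c_carrier c(2) by (intro Q.add.finprod_cong') (auto simp: carrier_quotient)
  finally have zx: "K +> ?z = K +> x"
    using sum by simp
  show ?thesis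
  proof (rule extensionalityI[of _ "carrier G"])
    fix g assume g: "g \<in> carrier G"
    have "F g = K +> (if g \<in> ?A then c g else \<zero>)"
      using g c(2) a_rcos_const[OF zero_closed] by (auto simp: zero_quotient)
    also have "\<dots> = K +> component R G Rg ?z g"
      using component_finsum[OF A, of c g] c g by simp
    also have "\<dots> = K +> component R G Rg x g"
      by (rule coset_component_cong[OF z x zx g])
    finally show "F g = (\<lambda>g\<in>carrier G. K +> component R G Rg x g) g"
      using g by simp
  qed (use hom in \<open>auto simp: PiE_def\<close>)
qed

lemma graded_ring_quotient: "graded_ring (R Quot K) G (quotient_grading R K Rg)"
proof (intro graded_ring.intro nonunital_ring_quotient grading_group.group_axioms
    graded_ring_axioms.intro)
  fix g assume "g \<in> carrier G"
  then show "additive_subgroup (quotient_grading R K Rg g) (R Quot K)"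
    by (simp add: quotient_grading_eq additive_subgroup_image homogeneous_subgroup)
next
  fix y assume "y \<in> carrier (R Quot K)"
  then obtain x where x: "x \<in> carrier R" and y: "y = K +> x"
    by (auto simp: carrier_quotient)
  show "\<exists>!f. homogeneous_decomposition (R Quot K) G (quotient_grading R K Rg) y f"
    unfolding y using homogeneous_decomposition_quotient[OF x] quotient_decomposition_unique[OF x]
    by (rule ex1I)
next
  fix g h x y
  assume gh: "g \<in> carrier G" "h \<in> carrier G"
    and "x \<in> quotient_grading R K Rg g" "y \<in> quotient_grading R K Rg h"
  then obtain a b where "a \<in> Rg g" "b \<in> Rg h" "x = K +> a" "y = K +> b"
    by (auto simp: quotient_grading_eq)
  then show "x \<otimes>\<^bsub>R Quot K\<^esub> y \<in> quotient_grading R K Rg (g \<otimes>\<^bsub>G\<^esub> h)"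
    using gh homogeneous_carrier homogeneous_mult by (auto simp: quotient_grading_eq coset_mult)
qed

lemma component_quotient:
  assumes "x \<in> carrier R" "g \<in> carrier G"
  shows "component (R Quot K) G (quotient_grading R K Rg) (K +> x) g = K +> component R G Rg x g"
  using graded_ring.component_unique[OF graded_ring_quotient _
      homogeneous_decomposition_quotient[OF assms(1)]] assms
  by (simp add: carrier_quotient)

lemma graded_right_ideal_image:
  assumes "graded_right_ideal R G Rg X"
  shows "graded_right_ideal (R Quot K) G (quotient_grading R K Rg) ((\<lambda>x. K +> x) ` X)"
proof -
  interpret X: graded_right_ideal R G Rg X by fact
  have "graded_subset (R Quot K) G (quotient_grading R K Rg) ((\<lambda>x. K +> x) ` X)"
    using X.graded by (auto simp: graded_subset_def component_quotient)
  then show ?thesis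
    by (intro graded_right_ideal.intro graded_ring_quotient right_ideal_image
        X.right_ideal_axioms graded_right_ideal_axioms.intro)
qed

lemma graded_right_ideal_preimage:
  assumes "graded_right_ideal (R Quot K) G (quotient_grading R K Rg) Z"
  shows "graded_right_ideal R G Rg {x \<in> carrier R. K +> x \<in> Z}"
proof -
  interpret Z: graded_right_ideal "R Quot K" G "quotient_grading R K Rg" Z by fact
  have "graded_subset R G Rg {x \<in> carrier R. K +> x \<in> Z}"
    using Z.graded component_carrier
    by (auto simp: graded_subset_def simp flip: component_quotient)
  then show ?thesis
    by (intro graded_right_ideal.intro graded_ring_axioms right_ideal_preimage
        Z.right_ideal_axioms graded_right_ideal_axioms.intro)
qed

end


section \<open>Almost prime right ideals of the quotient\<close>

theorem theorem2p16:
  fixes R :: "('a, 'm) ring_scheme"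
    and G :: "('g, 'n) monoid_scheme"
    and Rg :: "'g \<Rightarrow> 'a set"
    and K P :: "'a set"
  assumes "group G"
    and "graded_ring R G Rg"
    and "graded_proper_two_sided_ideal R G Rg K"
    and "graded_right_ideal R G Rg P"
    and "K \<subseteq> P"
    and "graded_almost_prime_right_ideal R G Rg P"
  shows "graded_almost_prime_right_ideal
    (R Quot K) G (quotient_grading R K Rg) (quotient_subset R K P)"
proof -
  interpret K: graded_proper_two_sided_ideal R G Rg K by fact
  interpret P: graded_almost_prime_right_ideal R G Rg P by fact
  let ?\<pi> = "\<lambda>x. K +>\<^bsub>R\<^esub> x"
  note mem_P = K.coset_mem_image_iff[OF P.additive_subgroup_axioms \<open>K \<subseteq> P\<close>]
  have "graded_almost_prime_right_ideal (R Quot K) G (quotient_grading R K Rg) (?\<pi> ` P)"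
  proof (intro graded_almost_prime_right_ideal.intro K.graded_right_ideal_image assms(4)
      graded_almost_prime_right_ideal_axioms.intro)
    show "?\<pi> ` P \<noteq> carrier (R Quot K)"
    proof
      assume "?\<pi> ` P = carrier (R Quot K)"
      then have "carrier R \<subseteq> P"
        using mem_P by (auto simp: K.carrier_quotient)
      then show False
        using P.proper P.a_subset by auto
    qed
  next
    fix X' Y'
    assume X': "graded_right_ideal (R Quot K) G (quotient_grading R K Rg) X'"
      and Y': "graded_right_ideal (R Quot K) G (quotient_grading R K Rg) Y'"
      and sub: "X' \<cdot>\<^bsub>R Quot K\<^esub> Y' \<subseteq> ?\<pi> ` P"
      and not_sub: "\<not> X' \<cdot>\<^bsub>R Quot K\<^esub> Y' \<subseteq> ?\<pi> ` P \<cdot>\<^bsub>R Quot K\<^esub> ?\<pi> ` P"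
    interpret X': graded_right_ideal "R Quot K" G "quotient_grading R K Rg" X' by fact
    interpret Y': graded_right_ideal "R Quot K" G "quotient_grading R K Rg" Y' by fact
    define X where "X = {x \<in> carrier R. ?\<pi> x \<in> X'}"
    define Y where "Y = {x \<in> carrier R. ?\<pi> x \<in> Y'}"
    have carrier: "X \<subseteq> carrier R" "Y \<subseteq> carrier R"
      by (auto simp: X_def Y_def)
    have img: "?\<pi> ` X = X'" "?\<pi> ` Y = Y'"
      unfolding X_def Y_def by (intro K.image_preimage X'.a_subset Y'.a_subset)+
    have prod: "?\<pi> ` (X \<cdot>\<^bsub>R\<^esub> Y) = X' \<cdot>\<^bsub>R Quot K\<^esub> Y'"
      using K.image_ideal_prod[OF carrier] img by simp
    have "X \<cdot>\<^bsub>R\<^esub> Y \<subseteq> P"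
    proof
      fix s assume s: "s \<in> X \<cdot>\<^bsub>R\<^esub> Y"
      then have "?\<pi> s \<in> ?\<pi> ` P"
        using prod sub by (metis imageI subsetD)
      then show "s \<in> P"
        using mem_P s K.ideal_prod_carrier[OF carrier] by auto
    qed
    moreover have "\<not> X \<cdot>\<^bsub>R\<^esub> Y \<subseteq> P \<cdot>\<^bsub>R\<^esub> P"
      using not_sub prod K.image_ideal_prod[OF P.a_subset P.a_subset] by (metis image_mono)
    ultimately have "X \<subseteq> P \<or> Y \<subseteq> P"
      using P.almost_prime[OF K.graded_right_ideal_preimage[OF X']
          K.graded_right_ideal_preimage[OF Y']]
      unfolding X_def Y_def by simp
    then show "X' \<subseteq> ?\<pi> ` P \<or> Y' \<subseteq> ?\<pi> ` P"
      using img by blast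
  qed
  then show ?thesis
    by (simp add: quotient_subset_def)
qed

end
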